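(* (i) For every $n\geq 1$, $s(n)$ divides $s(n-1)+s(n+1)$; more precisely $$\frac{s(n-1)+s(n+1)}{s(n)}=1+2v_2(n).$$ The power series $C(z)=\sum_{n=1}^\infty \frac{s(n-1)+s(n+1)}{s(n)}z^n$ satisfies $C(0)=0$ and $C(z)=z\frac{1+2z}{1-z^2}+C(z^2)$, and is $2$-regular. (ii) For $n\geq 1$: if $n=3\cdot 2^k$ for some $k\geq 0$, then $t(n)=0$ and $t(n-1)+t(n+1)=0$. Otherwise both $t(n)$ and $t(n-1)+t(n+1)$ are non-zero and $t(n)$ divides $t(n-1)+t(n+1)$; more precisely $$\frac{t(n-1)+t(n+1)}{t(n)}=1+2v_2(n)\quad\text{if } n\notin\{2^j: j\geq0\}\cup\{3\cdot 2^j: j\geq 0\},$$ $(t(0)+t(2))/t(1)=-1$, and $$\frac{t(2^e-1)+t(2^e+1)}{t(2^e)}=1+2(e-2)\quad\text{for all } e\geq 1.$$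
   Context: The Stern sequence $s$ is defined by $s(0)=0$, $s(1)=1$, $s(2n)=s(n)$, $s(2n+1)=s(n)+s(n+1)$ for $n\geq1$. The twisted Stern sequence $t$ is defined by $t(0)=0$, $t(1)=1$, $t(2n)=-t(n)$, $t(2n+1)=-t(n)-t(n+1)$ for $n\geq 1$. $v_2(n)$ is the exponent of the highest power of $2$ dividing $n$. A power series $A\in\mathbb Q[[z]]$ is $2$-regular if the smallest vector space containing $A$ and stable under the maps $\rho(i)\left(\sum_n a(n)z^n\right)=\sum_n a(i+2n)z^n$, $i=0,1$, is finite-dimensional. *)

theory Defs
  imports "HOL-Computational_Algebra.Computational_Algebra"
begin

function stern :: "nat \<Rightarrow> nat" where
  "stern n = (if n \<le> 1 then n
     else if even n then stern (n div 2)
     else stern (n div 2) + stern (n div 2 + 1))"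
  by pat_completeness auto
termination by (relation "Wellfounded.measure id") (auto elim!: oddE)

function twisted_stern :: "nat \<Rightarrow> int" where
  "twisted_stern n = (if n \<le> 1 then int n
     else if even n then - twisted_stern (n div 2)
     else - twisted_stern (n div 2) - twisted_stern (n div 2 + 1))"
  by pat_completeness auto
termination by (relation "Wellfounded.measure id") (auto elim!: oddE)

declare stern.simps [simp del] twisted_stern.simps [simp del]

(* At n = 0 the equation t(2n+1) = -t(n)-t(n+1) would contradict t(1) = 1, so it is imposed only for n >= 1. *)

lemma stern_rec:
  "stern 0 = 0"
  "stern 1 = 1"
  "n \<ge> 1 \<Longrightarrow> stern (2 * n) = stern n"
  "n \<ge> 1 \<Longrightarrow> stern (2 * n + 1) = stern n + stern (n + 1)"
  by (subst stern.simps; simp)+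

lemma twisted_stern_rec:
  "twisted_stern 0 = 0"
  "twisted_stern 1 = 1"
  "n \<ge> 1 \<Longrightarrow> twisted_stern (2 * n) = - twisted_stern n"
  "n \<ge> 1 \<Longrightarrow> twisted_stern (2 * n + 1) = - twisted_stern n - twisted_stern (n + 1)"
  by (subst twisted_stern.simps; simp)+

definition stern_quotient_fps :: "rat fps" where
  "stern_quotient_fps = Abs_fps (\<lambda>n. if n = 0 then 0
     else of_nat (stern (n - 1) + stern (n + 1)) / of_nat (stern n))"

global_interpretation fps_vs: vector_space "\<lambda>(c::rat) A. fps_const c * A"
  by unfold_locales (simp_all add: algebra_simps flip: fps_const_add fps_const_mult)

definition fps_section :: "nat \<Rightarrow> rat fps \<Rightarrow> rat fps" where
  "fps_section i A = Abs_fps (\<lambda>n. fps_nth A (i + 2 * n))"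

(* The hull is the intersection of all such subspaces containing A, i.e. the smallest one. *)
definition section_closure :: "rat fps \<Rightarrow> rat fps set" where
  "section_closure A =
     (\<lambda>V. fps_vs.subspace V \<and> (\<forall>i\<in>{0, 1}. \<forall>B\<in>V. fps_section i B \<in> V)) hull {A}"

definition two_regular :: "rat fps \<Rightarrow> bool" where
  "two_regular A \<longleftrightarrow> (\<exists>B. finite B \<and> fps_vs.span B = section_closure A)"

end

theory Submission imports Defs begin

text \<open>
  The neighbour sum $s(n-1)+s(n+1)$ equals $s(n)$ for odd $n$, and passing from $n$ to $2n$ adds
  $2s(n) = 2s(2n)$ to it, so the quotient grows by $2$. The twisted sequence satisfies the same two
  rules up to a common sign, but only away from $n=1$, which shifts the quotient at powers of $2$.
  Its zeros are exactly $3\cdot 2^k$ because the sign of $t$ is constant strictly between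
  consecutive such numbers. Up to linear combinations, sectioning $C$ only produces the series
  $1/(1-z)$ and $z/(1-z)$, whence $2$-regularity.
\<close>

section \<open>Neighbour sums of the Stern sequence\<close>

lemma stern_double: "stern (2 * n) = stern n"
  by (cases "n = 0") (use stern_rec in auto)

text \<open>For \<open>n = 0\<close> this reads 1 = 0 + 1, so the index 1 falls under the odd case
  from here on.\<close>

lemma stern_double_Suc: "stern (2 * n + 1) = stern n + stern (n + 1)"
proof (cases "n = 0")
  case True
  then show ?thesis
    using stern_rec(1,2) by simp
next
  case False
  then show ?thesis
    using stern_rec(4)[of n] by simp
qed

lemma stern_pos: "n \<ge> 1 \<Longrightarrow> stern n > 0"
proof (induction n rule: less_induct)
  case (less n)
  show ?case
  proof (cases "n = 1")
    case True
    then show ?thesis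
      using stern_rec(2) by simp
  next
    case False
    with less.prems have *: "n div 2 < n" "1 \<le> n div 2"
      by auto
    then have IH: "stern (n div 2) > 0"
      using less.IH by blast
    show ?thesis
    proof (cases "even n")
      case True
      then show ?thesis
        using IH stern_double[of "n div 2"] by simp
    next
      case False
      then have "stern n = stern (n div 2) + stern (n div 2 + 1)"
        using stern_double_Suc[of "n div 2"] by simp
      then show ?thesis
        using IH by simp
    qed
  qed
qed

text \<open>For \<open>n = 2 * m + 1\<close> the neighbours are \<open>2 * m\<close> and
  \<open>2 * (m + 1)\<close>; their values s(m) and s(m+1) are the two summands of s(n).\<close>

lemma stern_neighbours_odd:
  assumes "odd n"
  shows "stern (n - 1) + stern (n + 1) = stern n"
proof -
  obtain m where "n = 2 * m + 1"
    using assms by (elim oddE)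
  then show ?thesis
    using stern_double[of m] stern_double[of "m + 1"] stern_double_Suc[of m] by simp
qed

text \<open>Both neighbours of \<open>2 * n\<close> are odd, and they expand to s(n-1) + s(n) and
  s(n) + s(n+1).\<close>

lemma stern_neighbours_double:
  assumes "n \<ge> 1"
  shows "stern (2 * n - 1) + stern (2 * n + 1) = stern (n - 1) + stern (n + 1) + 2 * stern n"
proof -
  obtain k where k: "n = Suc k"
    using assms by (cases n) auto
  show ?thesis
    using stern_double_Suc[of k] stern_double_Suc[of n] by (simp add: k)
qed

lemma stern_neighbours_power_mult:
  assumes "odd m"
  shows "stern (2 ^ j * m - 1) + stern (2 ^ j * m + 1) = (1 + 2 * j) * stern (2 ^ j * m)"
proof (induction j)
  case 0
  then show ?case
    using stern_neighbours_odd[OF assms] by simp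
next
  case (Suc j)
  have "2 ^ j * m \<ge> 1"
    using odd_pos[OF assms] by (simp add: Suc_leI)
  then show ?case
    using stern_neighbours_double[of "2 ^ j * m"] Suc stern_double[of "2 ^ j * m"]
    by (simp add: mult.assoc add_mult_distrib)
qed

lemma nat_odd_part:
  fixes n :: nat
  assumes "n \<ge> 1"
  obtains m where "n = 2 ^ multiplicity 2 n * m" "odd m"
  using multiplicity_decompose'[of n 2] assms by auto

lemma stern_neighbours:
  assumes "n \<ge> 1"
  shows "stern (n - 1) + stern (n + 1) = (1 + 2 * multiplicity 2 n) * stern n"
proof -
  obtain m where m: "n = 2 ^ multiplicity 2 n * m" "odd m"
    using nat_odd_part[OF assms] .
  show ?thesis
    using stern_neighbours_power_mult[OF m(2), of "multiplicity 2 n"] m(1) by simp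
qed

lemma stern_quotient_eq:
  assumes "n \<ge> 1"
  shows "(of_nat (stern (n - 1) + stern (n + 1)) / of_nat (stern n) :: rat)
    = 1 + 2 * of_nat (multiplicity 2 n)"
  using stern_pos[OF assms] unfolding stern_neighbours[OF assms] by (simp add: field_simps)

section \<open>Coefficients and functional equation of C\<close>

lemma stern_quotient_fps_nth:
  "fps_nth stern_quotient_fps n = (if n = 0 then 0 else 1 + 2 * of_nat (multiplicity 2 n))"
  using stern_quotient_eq[of n] by (simp add: stern_quotient_fps_def)

lemma stern_quotient_fps_nth_double:
  "n \<noteq> 0 \<Longrightarrow> fps_nth stern_quotient_fps (2 * n) = 2 + fps_nth stern_quotient_fps n"
  by (simp add: stern_quotient_fps_nth multiplicity_times_same)

lemma stern_quotient_fps_nth_odd: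
  "odd n \<Longrightarrow> fps_nth stern_quotient_fps n = 1"
  by (auto simp: stern_quotient_fps_nth not_dvd_imp_multiplicity_0 elim: oddE)

lemma fps_one_plus_two_X_over:
  "(1 + 2 * fps_X) / (1 - fps_X ^ 2) = (Abs_fps (\<lambda>n. if even n then 1 else 2) :: rat fps)"
  (is "_ = ?E")
proof -
  have "1 + 2 * fps_X = ?E * (1 - fps_X ^ 2)"
  proof (rule fps_ext)
    fix n :: nat
    \<comment> \<open>Multiplying by 1 - X^2 subtracts the coefficient two places lower. From index
      2 on this cancels by periodicity; indices 0 and 1 leave 1 and 2.\<close>
    have "n = 0 \<or> n = 1 \<or> n \<ge> 2"
      by linarith
    then show "fps_nth (1 + 2 * fps_X) n = fps_nth (?E * (1 - fps_X ^ 2)) n"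
      by (auto simp: algebra_simps fps_X_power_mult_right_nth fps_X_power_mult_nth fps_numeral_nth numeral_fps_const)
  qed
  moreover have "(1 - fps_X ^ 2 :: rat fps) \<noteq> 0"
    by (rule fps_nonzeroI[of _ 0]) simp
  ultimately show ?thesis
    by simp
qed

text \<open>Coefficients are compared by parity. The series C(z^2) lives on even indices only, and
  the rational term contributes 1 at odd indices and 2 at positive even ones, matching the two
  coefficient rules for C.\<close>

lemma stern_quotient_fps_equation:
  "stern_quotient_fps =
     fps_X * ((1 + 2 * fps_X) / (1 - fps_X ^ 2)) + fps_compose stern_quotient_fps (fps_X ^ 2)"
proof (rule fps_ext)
  fix n
  show "fps_nth stern_quotient_fps n = fps_nth
    (fps_X * ((1 + 2 * fps_X) / (1 - fps_X ^ 2)) + fps_compose stern_quotient_fps (fps_X ^ 2)) n"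
  proof (cases "even n")
    case True
    then obtain k where "n = 2 * k"
      by blast
    then show ?thesis
      using stern_quotient_fps_nth_double[of k] stern_quotient_fps_nth[of 0]
      by (cases "k = 0") (simp_all add: fps_one_plus_two_X_over fps_nth_compose_X_power)
  next
    case False
    then show ?thesis
      by (auto simp: stern_quotient_fps_nth_odd fps_one_plus_two_X_over fps_nth_compose_X_power
          elim: oddE)
  qed
qed

section \<open>2-regularity of C\<close>

abbreviation geometric_fps :: "rat fps" where
  "geometric_fps \<equiv> Abs_fps (\<lambda>n. 1)"

text \<open>The constant term is dropped because doubling the index adds 2 to a coefficient of C
  only at positive indices.\<close>

abbreviation geometric_tail_fps :: "rat fps" where
  "geometric_tail_fps \<equiv> Abs_fps (\<lambda>n. if n = 0 then 0 else 1)"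

lemma fps_section_linear:
  "fps_section i 0 = 0"
  "fps_section i (A + B) = fps_section i A + fps_section i B"
  "fps_section i (fps_const c * A) = fps_const c * fps_section i A"
  by (simp_all add: fps_section_def fps_eq_iff)

text \<open>Sections are linear, so stability of a span can be tested on its generators.\<close>

lemma fps_section_span:
  assumes "\<And>B. B \<in> S \<Longrightarrow> fps_section i B \<in> fps_vs.span S" and "A \<in> fps_vs.span S"
  shows "fps_section i A \<in> fps_vs.span S"
  using assms(2)
proof (induction rule: fps_vs.span_induct_alt)
  case base
  then show ?case
    by (simp add: fps_section_linear(1) fps_vs.span_zero)
next
  case (step c x y)
  then show ?case
    by (simp add: fps_section_linear(2,3) fps_vs.span_add fps_vs.span_scale assms(1))
qed

lemma fps_section_stern_quotient:
  "fps_section 0 stern_quotient_fps = stern_quotient_fps + fps_const 2 * geometric_tail_fps"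
  "fps_section 1 stern_quotient_fps = geometric_fps"
proof -
  have "fps_nth stern_quotient_fps (2 * n)
      = fps_nth (stern_quotient_fps + fps_const 2 * geometric_tail_fps) n" for n
    using stern_quotient_fps_nth_double[of n] stern_quotient_fps_nth[of 0]
    by (cases "n = 0") simp_all
  then show "fps_section 0 stern_quotient_fps
      = stern_quotient_fps + fps_const 2 * geometric_tail_fps"
    by (simp add: fps_eq_iff fps_section_def)
  show "fps_section 1 stern_quotient_fps = geometric_fps"
    by (simp add: fps_eq_iff fps_section_def stern_quotient_fps_nth_odd)
qed

lemma fps_section_geometric:
  "fps_section i geometric_fps = geometric_fps"
  "fps_section 0 geometric_tail_fps = geometric_tail_fps"
  "fps_section 1 geometric_tail_fps = geometric_fps"
  by (simp_all add: fps_eq_iff fps_section_def)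

lemma section_closure_stern_quotient:
  "section_closure stern_quotient_fps
     = fps_vs.span {stern_quotient_fps, geometric_fps, geometric_tail_fps}"
  (is "_ = fps_vs.span ?S")
  unfolding section_closure_def
proof (rule hull_unique)
  show "{stern_quotient_fps} \<subseteq> fps_vs.span ?S"
    by (simp add: fps_vs.span_base)
  have "fps_section i B \<in> fps_vs.span ?S" if "i \<in> {0, 1}" "B \<in> ?S" for i B
    using that
    by (auto simp: fps_section_stern_quotient fps_section_geometric
        fps_section_stern_quotient(2)[simplified] fps_section_geometric(3)[simplified]
        intro!: fps_vs.span_add fps_vs.span_scale intro: fps_vs.span_base)
  then show "fps_vs.subspace (fps_vs.span ?S) \<and>
      (\<forall>i\<in>{0, 1}. \<forall>B\<in>fps_vs.span ?S. fps_section i B \<in> fps_vs.span ?S)"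
    using fps_section_span by blast
next
  fix V
  assume V: "{stern_quotient_fps} \<subseteq> V"
    "fps_vs.subspace V \<and> (\<forall>i\<in>{0, 1}. \<forall>B\<in>V. fps_section i B \<in> V)"
  then have sec: "fps_section 0 stern_quotient_fps \<in> V" "fps_section 1 stern_quotient_fps \<in> V"
    by auto
  \<comment> \<open>Conversely, any stable subspace containing C contains the other generators: the
    even section exceeds C by 2z/(1-z), and the odd section is 1/(1-z).\<close>
  have "fps_const (1/2) * (fps_section 0 stern_quotient_fps - stern_quotient_fps) \<in> V"
    using V sec by (intro fps_vs.subspace_scale fps_vs.subspace_diff) auto
  moreover have "fps_const (1/2) * (fps_section 0 stern_quotient_fps - stern_quotient_fps)
      = geometric_tail_fps"
    by (simp add: fps_section_stern_quotient(1) fps_eq_iff)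
  ultimately have "geometric_tail_fps \<in> V"
    by metis
  moreover have "geometric_fps \<in> V"
    using sec(2) by (metis fps_section_stern_quotient(2))
  ultimately have "?S \<subseteq> V"
    using V(1) by blast
  then show "fps_vs.span ?S \<subseteq> V"
    by (rule fps_vs.span_minimal) (use V in blast)
qed

lemma two_regular_stern_quotient: "two_regular stern_quotient_fps"
  unfolding two_regular_def section_closure_stern_quotient
  by (rule exI, rule conjI[OF _ refl]) simp

section \<open>Zeros and signs of the twisted sequence\<close>

lemma twisted_stern_double: "twisted_stern (2 * n) = - twisted_stern n"
  by (cases "n = 0") (use twisted_stern_rec in auto)

lemma twisted_stern_small:
  "twisted_stern 0 = 0" "twisted_stern 1 = 1" "twisted_stern 2 = -1" "twisted_stern 3 = 0"
proof -
  show *: "twisted_stern 0 = 0" "twisted_stern 1 = 1"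
    using twisted_stern_rec(1,2) by simp_all
  show **: "twisted_stern 2 = -1"
    using twisted_stern_double[of 1] * by simp
  show "twisted_stern 3 = 0"
    using twisted_stern_rec(4)[of 1] * ** by (simp add: numeral_2_eq_2 numeral_3_eq_3)
qed

lemma twisted_stern_power_mult: "twisted_stern (2 ^ j * m) = (-1) ^ j * twisted_stern m"
proof (induction j)
  case (Suc j)
  then show ?case
    using twisted_stern_double[of "2 ^ j * m"] by (simp add: mult.assoc)
qed simp

lemma twisted_stern_three_power: "twisted_stern (3 * 2 ^ k) = 0"
  using twisted_stern_power_mult[of k 3] by (simp add: twisted_stern_small mult.commute)

text \<open>Halving \<open>n\<close> moves one interval down and writes t(n) as minus a value, or
  minus a sum of two adjacent values, from that interval or its endpoints. The minus sign is
  absorbed by the extra factor -1, and endpoints contribute 0.\<close>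

lemma twisted_stern_sign:
  assumes "3 * 2 ^ k < n" "n < 3 * 2 ^ (k + 1)"
  shows "(-1) ^ k * twisted_stern n > 0"
  using assms
proof (induction k arbitrary: n)
  case 0
  then have "n = 2 * 2 \<or> n = 2 * 2 + 1"
    by auto
  then show ?case
    using twisted_stern_double[of 2] twisted_stern_rec(4)[of 2]
    by (auto simp: twisted_stern_small)
next
  case (Suc k)
  show ?case
  proof (cases "even n")
    case True
    then obtain m where m: "n = 2 * m"
      by blast
    with Suc.prems have "(-1) ^ k * twisted_stern m > 0"
      by (intro Suc.IH) auto
    then show ?thesis
      by (simp add: m twisted_stern_double)
  next
    case False
    then obtain m where m: "n = 2 * m + 1"
      by (elim oddE)
    have bounds: "3 * 2 ^ k \<le> m" "m < 3 * 2 ^ (k + 1)"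
      using Suc.prems by (auto simp: m)
    have "(0::nat) < 2 ^ k"
      by simp
    with bounds have "1 \<le> m"
      by linarith
    then have t: "twisted_stern n = - twisted_stern m - twisted_stern (m + 1)"
      unfolding m by (rule twisted_stern_rec(4))
    \<comment> \<open>The interval has an interior point next to each endpoint, so at most one of
      \<open>m\<close> and \<open>m + 1\<close> is an endpoint and the sum stays strictly
      positive.\<close>
    have gap: "3 * 2 ^ k + 1 < 3 * (2::nat) ^ (k + 1)"
      using \<open>0 < 2 ^ k\<close> unfolding power_add power_one_right by linarith
    consider "m = 3 * 2 ^ k" | "m + 1 = 3 * 2 ^ (k + 1)"
      | "3 * 2 ^ k < m" "m + 1 < 3 * 2 ^ (k + 1)"
      using bounds by linarith
    then have "(-1) ^ k * twisted_stern m + (-1) ^ k * twisted_stern (m + 1) > 0"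
    proof cases
      case 1
      then have "(-1) ^ k * twisted_stern (m + 1) > 0"
        using gap by (intro Suc.IH) auto
      then show ?thesis
        using 1 twisted_stern_three_power[of k] by simp
    next
      case 2
      then have "(-1) ^ k * twisted_stern m > 0"
        using gap by (intro Suc.IH) auto
      then show ?thesis
        using 2 twisted_stern_three_power[of "k + 1"] by simp
    next
      case 3
      then show ?thesis
        using Suc.IH[of m] Suc.IH[of "m + 1"] by simp
    qed
    then show ?thesis
      by (simp add: t algebra_simps)
  qed
qed

lemma twisted_stern_eq_0_iff:
  assumes "n \<ge> 1"
  shows "twisted_stern n = 0 \<longleftrightarrow> (\<exists>k. n = 3 * 2 ^ k)"
proof
  assume 0: "twisted_stern n = 0"
  show "\<exists>k. n = 3 * 2 ^ k"
  proof (cases "n < 3")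
    case True
    with assms have "n = 1 \<or> n = 2"
      by auto
    with 0 show ?thesis
      using twisted_stern_small by auto
  next
    case False
    \<comment> \<open>This locates \<open>n\<close> in the interval from \<open>3 * 2 ^ k\<close> to
      \<open>3 * 2 ^ (k + 1)\<close>; the sign lemma then leaves only the left endpoint.\<close>
    obtain k where k: "2 ^ k \<le> n div 3" "n div 3 < 2 ^ (k + 1)"
      using ex_power_ivl1[of 2 "n div 3"] False by (auto simp: Suc_le_eq div_greater_zero_iff)
    then have "3 * 2 ^ k \<le> n" "n < 3 * 2 ^ (k + 1)"
      by auto
    moreover have "\<not> 3 * 2 ^ k < n"
      using twisted_stern_sign[of k n] calculation(2) 0 by auto
    ultimately show ?thesis
      by (intro exI[of _ k]) simp
  qed
next
  assume "\<exists>k. n = 3 * 2 ^ k"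
  then show "twisted_stern n = 0"
    using twisted_stern_three_power by blast
qed

section \<open>Neighbour sums of the twisted sequence\<close>

lemma twisted_stern_neighbours_odd:
  assumes "odd n" "n \<ge> 3"
  shows "twisted_stern (n - 1) + twisted_stern (n + 1) = twisted_stern n"
proof -
  obtain m where m: "n = 2 * m + 1"
    using assms(1) by (elim oddE)
  \<comment> \<open>The bound on \<open>n\<close> gives \<open>m \<ge> 1\<close>, where the odd
    recursion holds; at index 1 the neighbour sum is -1 although t(1) = 1.\<close>
  then show ?thesis
    using assms(2) twisted_stern_rec(4)[of m] twisted_stern_double[of m]
      twisted_stern_double[of "m + 1"] by simp
qed

lemma twisted_stern_neighbours_double:
  assumes "n \<ge> 2"
  shows "twisted_stern (2 * n - 1) + twisted_stern (2 * n + 1)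
    = - (twisted_stern (n - 1) + twisted_stern (n + 1)) - 2 * twisted_stern n"
proof -
  obtain k where k: "n = Suc k" "k \<ge> 1"
    using assms by (cases n) auto
  show ?thesis
    using twisted_stern_rec(4)[of k] twisted_stern_rec(4)[of n] k by simp
qed

text \<open>Doubling negates t as well as the neighbour sum, so the signs cancel and the factor
  grows by 2. The starting factor \<open>a\<close> is left free: it is 1 for odd
  \<open>m \<ge> 3\<close> and -1 for \<open>m = 2\<close>.\<close>

lemma twisted_stern_neighbours_power_mult:
  assumes "m \<ge> 2" "twisted_stern (m - 1) + twisted_stern (m + 1) = a * twisted_stern m"
  shows "twisted_stern (2 ^ j * m - 1) + twisted_stern (2 ^ j * m + 1)
    = (a + 2 * int j) * twisted_stern (2 ^ j * m)"
proof (induction j)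
  case 0
  then show ?case
    using assms(2) by simp
next
  case (Suc j)
  have "2 ^ j * m \<ge> 1 * 2"
    using assms(1) by (intro mult_le_mono) auto
  then show ?case
    using twisted_stern_neighbours_double[of "2 ^ j * m"] Suc twisted_stern_double[of "2 ^ j * m"]
    by (simp add: mult.assoc algebra_simps)
qed

lemma twisted_stern_neighbours:
  assumes "n \<ge> 1" "\<nexists>j. n = 2 ^ j"
  shows "twisted_stern (n - 1) + twisted_stern (n + 1)
    = (1 + 2 * int (multiplicity 2 n)) * twisted_stern n"
proof -
  obtain m where m: "n = 2 ^ multiplicity 2 n * m" "odd m"
    using nat_odd_part[OF assms(1)] .
  have "m \<noteq> 1"
    using m(1) assms(2) by auto
  with m(2) have "m \<ge> 3"
    by presburger
  then show ?thesis
    using twisted_stern_neighbours_power_mult[of m 1 "multiplicity 2 n"]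
      twisted_stern_neighbours_odd[OF m(2)] m(1) by simp
qed

text \<open>The doubling starts at 2, where t(1) + t(3) = 1 = -t(2). After e - 1 doublings the
  factor is -1 + 2(e-1) = 1 + 2(e-2).\<close>

lemma twisted_stern_neighbours_power:
  assumes "e \<ge> 1"
  shows "twisted_stern (2 ^ e - 1) + twisted_stern (2 ^ e + 1)
    = (1 + 2 * (int e - 2)) * twisted_stern (2 ^ e)"
proof -
  obtain j where j: "e = Suc j"
    using assms by (cases e) auto
  show ?thesis
    using twisted_stern_neighbours_power_mult[of 2 "-1" j] twisted_stern_small
    by (simp add: j mult.commute numeral_3_eq_3)
qed

text \<open>An odd factor is nonzero, so this yields both divisibility and the nonvanishing of the
  neighbour sum wherever t(n) is nonzero. It covers all indices at once, with factor -1 at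
  \<open>n = 1\<close>.\<close>

lemma twisted_stern_neighbours_odd_multiple:
  assumes "n \<ge> 1"
  shows "\<exists>c. odd c \<and> twisted_stern (n - 1) + twisted_stern (n + 1) = c * twisted_stern n"
proof (cases "\<exists>j. n = 2 ^ j")
  case True
  then obtain j where j: "n = 2 ^ j"
    by blast
  show ?thesis
  proof (cases "j = 0")
    case True
    then show ?thesis
      using twisted_stern_small by (intro exI[of _ "-1"]) (simp add: j numeral_2_eq_2)
  next
    case False
    then show ?thesis
      using twisted_stern_neighbours_power[of j] j
      by (intro exI[of _ "1 + 2 * (int j - 2)"]) simp
  qed
next
  case False
  then show ?thesis
    using twisted_stern_neighbours[OF assms]
    by (intro exI[of _ "1 + 2 * int (multiplicity 2 n)"]) simp
qed

theorem mainTheorem8: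
  shows
    "((\<forall>n\<ge>1. stern n dvd stern (n - 1) + stern (n + 1) \<and>
        (of_nat (stern (n - 1) + stern (n + 1)) / of_nat (stern n) :: rat)
          = 1 + 2 * of_nat (multiplicity 2 n)) \<and>
     fps_nth stern_quotient_fps 0 = 0 \<and>
     stern_quotient_fps =
       fps_X * ((1 + 2 * fps_X) / (1 - fps_X ^ 2)) + fps_compose stern_quotient_fps (fps_X ^ 2) \<and>
     two_regular stern_quotient_fps \<and>
     (\<forall>n\<ge>1.
        ((\<exists>k. n = 3 * 2 ^ k) \<longrightarrow>
           twisted_stern n = 0 \<and> twisted_stern (n - 1) + twisted_stern (n + 1) = 0) \<and>
        (\<not> (\<exists>k. n = 3 * 2 ^ k) \<longrightarrow>
           twisted_stern n \<noteq> 0 \<and> twisted_stern (n - 1) + twisted_stern (n + 1) \<noteq> 0 \<and>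
           twisted_stern n dvd twisted_stern (n - 1) + twisted_stern (n + 1))) \<and>
     (\<forall>n\<ge>1. n \<notin> {2 ^ j | j. True} \<union> {3 * 2 ^ j | j. True} \<longrightarrow>
        (of_int (twisted_stern (n - 1) + twisted_stern (n + 1)) / of_int (twisted_stern n) :: rat)
          = 1 + 2 * of_nat (multiplicity 2 n)) \<and>
     (of_int (twisted_stern 0 + twisted_stern 2) / of_int (twisted_stern 1) :: rat) = -1 \<and>
     (\<forall>e\<ge>1.
        (of_int (twisted_stern (2 ^ e - 1) + twisted_stern (2 ^ e + 1))
           / of_int (twisted_stern (2 ^ e)) :: rat)
          = 1 + 2 * (of_nat e - 2)))"
proof (intro conjI allI impI, goal_cases)
  case (1 n)
  then show ?case
    by (subst stern_neighbours) auto
next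
  case (2 n)
  then show ?case
    by (rule stern_quotient_eq)
next
  case 3
  show ?case
    by (simp add: stern_quotient_fps_def)
next
  case 4
  show ?case
    by (rule stern_quotient_fps_equation)
next
  case 5
  show ?case
    by (rule two_regular_stern_quotient)
next
  case (6 n)
  then show ?case
    using twisted_stern_eq_0_iff by simp
next
  case (7 n)
  then show ?case
    using twisted_stern_eq_0_iff[of n] twisted_stern_neighbours_odd_multiple[of n] by auto
next
  case (8 n)
  then show ?case
    using twisted_stern_eq_0_iff[of n] by simp
next
  case (9 n)
  then show ?case
    using twisted_stern_eq_0_iff[of n] twisted_stern_neighbours_odd_multiple[of n] by auto
next
  case (10 n)
  then show ?case
    using twisted_stern_neighbours_odd_multiple[of n] by auto
next
  case (11 n)
  then have "twisted_stern n \<noteq> 0" "\<nexists>j. n = 2 ^ j"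
    using twisted_stern_eq_0_iff[of n] by auto
  then show ?case
    unfolding twisted_stern_neighbours[OF \<open>1 \<le> n\<close> \<open>\<nexists>j. n = 2 ^ j\<close>] by simp
next
  case 12
  show ?case
    using twisted_stern_small by simp
next
  case (13 e)
  \<comment> \<open>The value is (-1)^e, by repeated doubling from t(1) = 1.\<close>
  have "twisted_stern (2 ^ e) \<noteq> 0"
    using twisted_stern_power_mult[of e 1] twisted_stern_small(2) by simp
  then show ?case
    unfolding twisted_stern_neighbours_power[OF 13] by simp
qed

end
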